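(* Let $I$ be a finite set and let $\mathcal{O}$ and $\mathcal{O}'$ be orbit polytopes in $\mathbb{R}I$. Then $\mathcal{O}$ and $\mathcal{O}'$ are normally equivalent if and only if they have the same composition.
   Context: $\mathbb{R}I$ is the real vector space with basis $\{e_i:i\in I\}$ and $\mathbb{R}^I$ its dual. The group $\mathfrak{S}_I$ of permutations of $I$ acts on $\mathbb{R}I$ by $\sigma(p)_i=p_{\sigma^{-1}(i)}$. The orbit polytope of $p\in\mathbb{R}I$ is $\mathcal{O}(p)=\operatorname{conv}\{\sigma(p):\sigma\in\mathfrak{S}_I\}$. For a face $F$ of a polytope $P\subset\mathbb{R}I$, $\mathcal{N}_P(F)$ is the cone of $y\in\mathbb{R}^I$ attaining their maximum value over $P$ at every point of $F$; the normal fan is $\mathcal{N}_P=\{\mathcal{N}_P(F):F\le P\}$; $P,Q$ are normally equivalent if $\mathcal{N}_P=\mathcal{N}_Q$. Compositions. A composition of $n$ is a finite sequence of positive integers with sum $n$. Fix a linear order $\prec$ on $I$ and let $D=\{x\in\mathbb{R}I: i\prec j\Rightarrow x_i\ge x_j\}$ (the fundamental chamber of the braid arrangement $\{x_i=x_j\}_{i\neq j}$). Faces of $D$ correspond to compositions $(\alpha_1,\dots,\alpha_k)$ of $|I|$: the corresponding face consists of the points of $D$ whose first $\alpha_1$ coordinates (in the order $\prec$) are equal, whose next $\alpha_2$ coordinates are equal, and so on. The composition of $p\in\mathbb{R}I$ is the one corresponding to the unique face of $D$ whose relative interior contains a point of the $\mathfrak{S}_I$-orbit of $p$; equivalently $\alpha_j$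 is the number of coordinates of $p$ equal to its $j$-th largest distinct coordinate value. All vertices of an orbit polytope have the same composition, which is called the composition of the orbit polytope. *)

theory Defs
  imports "HOL-Analysis.Analysis" "HOL-Combinatorics.Permutations"
begin

text \<open>
  The finite index set is a subset \<open>I\<close> of a finite type, so that the empty index set is
  included and the library's notions for Euclidean spaces (convex hull, face, relative interior)
  apply.  The space with basis \<open>e\<^sub>i\<close> for \<open>i \<in> I\<close> is the coordinate subspace of \<open>real ^ 'i\<close>
  of vectors vanishing outside \<open>I\<close>.  Its dual is represented by the same coordinate subspace,
  with \<open>y\<close> acting as \<open>x \<mapsto> y \<bullet> x\<close>, which is the sum of \<open>y\<^sub>i x\<^sub>i\<close> over \<open>i \<in> I\<close>.
\<close>

definition coord_space :: "'i::finite set \<Rightarrow> (real ^ 'i) set" where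
  "coord_space I = {x. \<forall>i. i \<notin> I \<longrightarrow> x $ i = 0}"

definition perm_act :: "('i::finite \<Rightarrow> 'i) \<Rightarrow> real ^ 'i \<Rightarrow> real ^ 'i" where
  "perm_act \<sigma> p = (\<chi> i. p $ (inv \<sigma> i))"

definition perm_orbit :: "'i::finite set \<Rightarrow> real ^ 'i \<Rightarrow> (real ^ 'i) set" where
  "perm_orbit I p = {perm_act \<sigma> p | \<sigma>. \<sigma> permutes I}"

definition orbit_polytope :: "'i::finite set \<Rightarrow> real ^ 'i \<Rightarrow> (real ^ 'i) set" where
  "orbit_polytope I p = convex hull (perm_orbit I p)"

definition is_orbit_polytope :: "'i::finite set \<Rightarrow> (real ^ 'i) set \<Rightarrow> bool" where
  "is_orbit_polytope I P \<longleftrightarrow> (\<exists>p \<in> coord_space I. P = orbit_polytope I p)"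

definition normal_cone :: "'i::finite set \<Rightarrow> (real ^ 'i) set \<Rightarrow> (real ^ 'i) set \<Rightarrow> (real ^ 'i) set"
  where "normal_cone I P F = {y \<in> coord_space I. \<forall>x\<in>F. \<forall>z\<in>P. y \<bullet> z \<le> y \<bullet> x}"

text \<open>
  The empty set satisfies \<^const>\<open>face_of\<close>, but it is not counted as a face in a normal fan.
\<close>

definition normal_fan :: "'i::finite set \<Rightarrow> (real ^ 'i) set \<Rightarrow> (real ^ 'i) set set" where
  "normal_fan I P = {normal_cone I P F | F. F face_of P \<and> F \<noteq> {}}"

definition normally_equivalent ::
    "'i::finite set \<Rightarrow> (real ^ 'i) set \<Rightarrow> (real ^ 'i) set \<Rightarrow> bool" where
  "normally_equivalent I P Q \<longleftrightarrow> normal_fan I P = normal_fan I Q"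

definition is_composition :: "nat \<Rightarrow> nat list \<Rightarrow> bool" where
  "is_composition n \<alpha> \<longleftrightarrow> (\<forall>a \<in> set \<alpha>. 0 < a) \<and> sum_list \<alpha> = n"

text \<open>
  In what follows \<open>r\<close> is a (reflexive) linear order on \<open>I\<close>; \<open>(i, j) \<in> r\<close> means that \<open>i\<close> comes
  before \<open>j\<close> or equals it.
\<close>

definition chamber :: "'i::finite set \<Rightarrow> 'i rel \<Rightarrow> (real ^ 'i) set" where
  "chamber I r = {x \<in> coord_space I. \<forall>i\<in>I. \<forall>j\<in>I. (i, j) \<in> r \<and> i \<noteq> j \<longrightarrow> x $ j \<le> x $ i}"

text \<open>The position of an element, counted from 0, and the \<open>k\<close>-th block of consecutive elements.\<close>

definition position :: "'i::finite set \<Rightarrow> 'i rel \<Rightarrow> 'i \<Rightarrow> nat" where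
  "position I r i = card {j \<in> I. (j, i) \<in> r \<and> j \<noteq> i}"

definition block :: "'i::finite set \<Rightarrow> 'i rel \<Rightarrow> nat list \<Rightarrow> nat \<Rightarrow> 'i set" where
  "block I r \<alpha> k =
     {i \<in> I. sum_list (take k \<alpha>) \<le> position I r i \<and> position I r i < sum_list (take (Suc k) \<alpha>)}"

definition chamber_face :: "'i::finite set \<Rightarrow> 'i rel \<Rightarrow> nat list \<Rightarrow> (real ^ 'i) set" where
  "chamber_face I r \<alpha> =
     {x \<in> chamber I r. \<forall>k < length \<alpha>. \<forall>i \<in> block I r \<alpha> k. \<forall>j \<in> block I r \<alpha> k. x $ i = x $ j}"

definition point_composition :: "'i::finite set \<Rightarrow> 'i rel \<Rightarrow> real ^ 'i \<Rightarrow> nat list" where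
  "point_composition I r p =
     (THE \<alpha>. is_composition (card I) \<alpha> \<and>
             rel_interior (chamber_face I r \<alpha>) \<inter> perm_orbit I p \<noteq> {})"

text \<open>The vertices of a polytope are its extreme points.\<close>

definition polytope_composition :: "'i::finite set \<Rightarrow> 'i rel \<Rightarrow> (real ^ 'i) set \<Rightarrow> nat list" where
  "polytope_composition I r P =
     (THE \<alpha>. \<forall>v. v extreme_point_of P \<longrightarrow> point_composition I r v = \<alpha>)"

end

theory Submission
  imports Defs
begin

text \<open>
  By the rearrangement inequality, the normal cone of an orbit polytope at a vertex \<open>v\<close> consists
  of the vectors \<open>w\<close> with \<open>w\<^sub>j \<le> w\<^sub>i\<close> whenever \<open>v\<^sub>j < v\<^sub>i\<close>. It depends only on the strict order of
  the coordinates of \<open>v\<close>, and every cone of the normal fan is an intersection of such cones. Hence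
  if the representatives \<open>x\<close> and \<open>y\<close> of two orbits in the fundamental chamber have equal
  coordinates in the same places, the fans agree. Conversely, an interior vector of the chamber
  lies in exactly one cone of the fan, the normal cone at the representative, and this cone
  determines the strict order of the coordinates. On the other side, a composition
  is encoded by the set of its partial sums, which are the positions where the coordinates of
  the representative drop.
\<close>

section \<open>Permutation orbits and comonotone vectors\<close>

text \<open>No pair of coordinates may be ordered strictly in opposite ways, so the relation is
  symmetric in \<open>v\<close> and \<open>w\<close>. A tie in \<open>v\<close> puts no constraint
  on \<open>w\<close>.\<close>

definition comonotone :: "'i::finite set \<Rightarrow> real ^ 'i \<Rightarrow> real ^ 'i \<Rightarrow> bool" where
  "comonotone I v w \<longleftrightarrow> (\<forall>i\<in>I. \<forall>j\<in>I. v $ j < v $ i \<longrightarrow> w $ j \<le> w $ i)"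

definition comonotone_cone :: "'i::finite set \<Rightarrow> real ^ 'i \<Rightarrow> (real ^ 'i) set" where
  "comonotone_cone I v = {w \<in> coord_space I. comonotone I v w}"

lemma perm_act_nth [simp]: "perm_act \<sigma> p $ i = p $ inv \<sigma> i"
  by (simp add: perm_act_def)

lemma perm_act_compose:
  assumes "\<sigma> permutes I" "\<tau> permutes I"
  shows "perm_act \<sigma> (perm_act \<tau> p) = perm_act (\<sigma> \<circ> \<tau>) p"
  using assms by (simp add: vec_eq_iff o_inv_distrib permutes_bij)

lemma perm_act_id [simp]: "perm_act id p = p"
  by (simp add: vec_eq_iff)

lemma finite_perm_orbit: "finite (perm_orbit I p)"
proof -
  have "perm_orbit I p = (\<lambda>\<sigma>. perm_act \<sigma> p) ` {\<sigma>. \<sigma> permutes I}"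
    by (auto simp: perm_orbit_def)
  then show ?thesis by (simp add: finite_permutations)
qed

lemma perm_orbit_self: "p \<in> perm_orbit I p"
  unfolding perm_orbit_def using permutes_id perm_act_id by (metis (mono_tags, lifting) mem_Collect_eq)

lemma perm_act_in_perm_orbit:
  assumes "\<sigma> permutes I" "v \<in> perm_orbit I p"
  shows "perm_act \<sigma> v \<in> perm_orbit I p"
proof -
  obtain \<tau> where "\<tau> permutes I" "v = perm_act \<tau> p"
    using assms(2) by (auto simp: perm_orbit_def)
  with assms(1) have "perm_act \<sigma> v = perm_act (\<sigma> \<circ> \<tau>) p" "\<sigma> \<circ> \<tau> permutes I"
    by (auto simp: perm_act_compose[of _ I] intro: permutes_compose)
  then show ?thesis by (auto simp: perm_orbit_def)
qed

lemma perm_orbit_sym: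
  assumes "v \<in> perm_orbit I p"
  shows "p \<in> perm_orbit I v"
proof -
  obtain \<sigma> where \<sigma>: "\<sigma> permutes I" "v = perm_act \<sigma> p"
    using assms by (auto simp: perm_orbit_def)
  then have "perm_act (inv \<sigma>) v = p"
    by (simp add: perm_act_compose[OF permutes_inv[OF \<sigma>(1)] \<sigma>(1)] permutes_inv_o(2)[OF \<sigma>(1)])
  with permutes_inv[OF \<sigma>(1)] show ?thesis
    unfolding perm_orbit_def by (metis (mono_tags, lifting) mem_Collect_eq)
qed

lemma perm_orbit_eq:
  assumes "v \<in> perm_orbit I p"
  shows "perm_orbit I v = perm_orbit I p"
proof -
  have "perm_orbit I v \<subseteq> perm_orbit I p" if "v \<in> perm_orbit I p" for v p
    using that perm_act_in_perm_orbit[OF _ that] by (auto simp: perm_orbit_def)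
  then show ?thesis using assms perm_orbit_sym by blast
qed

lemma perm_orbit_coord_space:
  assumes "p \<in> coord_space I" "v \<in> perm_orbit I p"
  shows "v \<in> coord_space I"
proof -
  obtain \<sigma> where \<sigma>: "\<sigma> permutes I" "v = perm_act \<sigma> p"
    using assms(2) by (auto simp: perm_orbit_def)
  with assms(1) permutes_not_in[OF permutes_inv[OF \<sigma>(1)]] show ?thesis
    by (auto simp: coord_space_def)
qed

text \<open>A permutation carries the superlevel sets of \<open>p\<close> onto those of
  \<open>v\<close>. Their sizes are the orbit invariant used below.\<close>

lemma card_superlevel_perm_orbit:
  assumes "v \<in> perm_orbit I p"
  shows "card {i\<in>I. c < v $ i} = card {i\<in>I. c < p $ i}"
proof -
  obtain \<sigma> where \<sigma>: "\<sigma> permutes I" "v = perm_act \<sigma> p"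
    using assms by (auto simp: perm_orbit_def)
  have "{i\<in>I. c < v $ i} = \<sigma> ` {i\<in>I. c < p $ i}"
  proof -
    have "\<exists>j\<in>{i\<in>I. c < p $ i}. i = \<sigma> j" if "i \<in> I" "c < v $ i" for i
      using that \<sigma>(2)
      by (intro bexI[of _ "inv \<sigma> i"])
        (auto simp: permutes_inverses(1)[OF \<sigma>(1)] permutes_in_image[OF permutes_inv[OF \<sigma>(1)]])
    then show ?thesis
      using \<sigma>(2) by (auto simp: permutes_inverses(2)[OF \<sigma>(1)] permutes_in_image[OF \<sigma>(1)])
  qed
  then show ?thesis
    by (simp add: card_image permutes_inj_on[OF \<sigma>(1)])
qed

text \<open>Superlevel sets of \<open>u\<close> and \<open>v\<close> at the same level have the same
  size. If they differed, each would contain an index missing from the other, and these two indices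
  would be ordered in opposite ways. Equal superlevel sets force equal coordinates.\<close>

lemma comonotone_perm_orbit_eq:
  assumes "v \<in> coord_space I" "u \<in> perm_orbit I v" "comonotone I v u"
  shows "u = v"
proof -
  have eq: "{i\<in>I. c < u $ i} = {i\<in>I. c < v $ i}" for c
  proof (rule ccontr)
    let ?U = "{i\<in>I. c < u $ i}" and ?V = "{i\<in>I. c < v $ i}"
    assume "?U \<noteq> ?V"
    moreover have "card ?U = card ?V"
      using assms(2) by (rule card_superlevel_perm_orbit)
    ultimately obtain i j where "i \<in> ?V" "i \<notin> ?U" "j \<in> ?U" "j \<notin> ?V"
      by (metis (no_types, lifting) card_subset_eq finite subsetI)
    then show False
      using assms(3) unfolding comonotone_def by fastforce
  qed
  have "c < u $ i \<longleftrightarrow> c < v $ i" if "i \<in> I" for c i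
    using eq[of c] that by blast
  then have "u $ i = v $ i" if "i \<in> I" for i
    using that by (metis less_irrefl linorder_neqE)
  moreover have "u \<in> coord_space I"
    using assms(1,2) by (rule perm_orbit_coord_space)
  ultimately show ?thesis
    using assms(1) unfolding coord_space_def vec_eq_iff mem_Collect_eq by metis
qed

section \<open>The rearrangement inequality and normal cones at vertices\<close>

text \<open>Only the coordinates \<open>i\<close> and \<open>j\<close> contribute. This is the
  exchange step of the rearrangement inequality.\<close>

lemma inner_perm_act_transpose_diff:
  fixes v w :: "real ^ 'i::finite"
  assumes "i \<noteq> j"
  shows "w \<bullet> v - w \<bullet> perm_act (Transposition.transpose i j) v = (w $ i - w $ j) * (v $ i - v $ j)"
proof -
  have "w \<bullet> v - w \<bullet> perm_act (Transposition.transpose i j) v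
      = (\<Sum>k\<in>UNIV. w $ k * (v $ k - v $ Transposition.transpose i j k))"
    by (simp add: inner_vec_def sum_subtractf right_diff_distrib)
  also have "\<dots> = (\<Sum>k\<in>{i, j}. w $ k * (v $ k - v $ Transposition.transpose i j k))"
    by (rule sum.mono_neutral_right) (auto simp: Transposition.transpose_def)
  also have "\<dots> = (w $ i - w $ j) * (v $ i - v $ j)"
    using assms by (simp add: algebra_simps)
  finally show ?thesis .
qed

text \<open>Swapping two coordinates of a maximiser stays in the orbit and cannot increase the
  value, so the product in the exchange formula is nonnegative.\<close>

lemma maximiser_comonotone:
  assumes "v \<in> perm_orbit I p" "\<forall>u\<in>perm_orbit I p. w \<bullet> u \<le> w \<bullet> v"
  shows "comonotone I v w"
  unfolding comonotone_def
proof (intro ballI impI)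
  fix i j assume ij: "i \<in> I" "j \<in> I" "v $ j < v $ i"
  then have "perm_act (Transposition.transpose i j) v \<in> perm_orbit I p"
    by (intro perm_act_in_perm_orbit permutes_swap_id assms(1))
  then have "0 \<le> w \<bullet> v - w \<bullet> perm_act (Transposition.transpose i j) v"
    using assms(2) by simp
  also have "\<dots> = (w $ i - w $ j) * (v $ i - v $ j)"
    using ij by (intro inner_perm_act_transpose_diff) auto
  finally show "w $ j \<le> w $ i"
    using ij(3) by (simp add: zero_le_mult_iff)
qed

lemma perm_orbit_maximiser:
  obtains u where "u \<in> perm_orbit I p" "\<forall>u'\<in>perm_orbit I p. w \<bullet> u' \<le> w \<bullet> u"
proof -
  let ?M = "Max ((\<bullet>) w ` perm_orbit I p)"
  have "?M \<in> (\<bullet>) w ` perm_orbit I p"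
    using perm_orbit_self[of p I] by (intro Max_in) (auto simp: finite_perm_orbit)
  then obtain u where u: "u \<in> perm_orbit I p" "w \<bullet> u = ?M" by auto
  then have "\<forall>u'\<in>perm_orbit I p. w \<bullet> u' \<le> w \<bullet> u"
    by (simp add: finite_perm_orbit)
  with u show thesis using that by blast
qed

text \<open>
  For \<open>\<epsilon> > 0\<close> the vector \<open>w + \<epsilon> v\<close> is strictly increasing in \<open>v\<close>,
  so \<open>v\<close> is the only possible maximiser of \<open>w + \<epsilon> v\<close> over the orbit; then \<open>\<epsilon>\<close> tends to \<open>0\<close>.
\<close>

lemma comonotone_maximiser:
  assumes v: "v \<in> coord_space I" and com: "comonotone I v w" and u: "u \<in> perm_orbit I v"
  shows "w \<bullet> u \<le> w \<bullet> v"
proof -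
  have pert: "(w + \<epsilon> *\<^sub>R v) \<bullet> u \<le> (w + \<epsilon> *\<^sub>R v) \<bullet> v" if "\<epsilon> > 0" for \<epsilon>
  proof -
    let ?w = "w + \<epsilon> *\<^sub>R v"
    obtain m where m: "m \<in> perm_orbit I v" "\<forall>u'\<in>perm_orbit I v. ?w \<bullet> u' \<le> ?w \<bullet> m"
      by (rule perm_orbit_maximiser)
    have m_com: "comonotone I m ?w"
      using m by (rule maximiser_comonotone)
    have "comonotone I v m"
      unfolding comonotone_def
    proof (intro ballI impI)
      fix i j assume ij: "i \<in> I" "j \<in> I" "v $ j < v $ i"
      then have "?w $ j < ?w $ i"
        using com that unfolding comonotone_def
        by (simp add: add_le_less_mono)
      then show "m $ j \<le> m $ i"
        using m_com ij unfolding comonotone_def by (meson not_less)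
    qed
    then have "m = v"
      using v m(1) by (intro comonotone_perm_orbit_eq)
    then show ?thesis using m(2) u by blast
  qed
  show ?thesis
  proof (rule tendsto_le)
    show "((\<lambda>\<epsilon>. (w + \<epsilon> *\<^sub>R v) \<bullet> v) \<longlongrightarrow> w \<bullet> v) (at_right 0)"
      by (auto intro!: tendsto_eq_intros)
    show "((\<lambda>\<epsilon>. (w + \<epsilon> *\<^sub>R v) \<bullet> u) \<longlongrightarrow> w \<bullet> u) (at_right 0)"
      by (auto intro!: tendsto_eq_intros)
    show "\<forall>\<^sub>F \<epsilon> in at_right 0. (w + \<epsilon> *\<^sub>R v) \<bullet> u \<le> (w + \<epsilon> *\<^sub>R v) \<bullet> v"
      using pert by (auto simp: eventually_at_right_field intro: exI[of _ 1])
  qed simp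
qed

lemma normal_cone_perm_orbit:
  assumes "p \<in> coord_space I" "v \<in> perm_orbit I p"
  shows "normal_cone I (perm_orbit I p) {v} = comonotone_cone I v"
  using maximiser_comonotone[OF assms(2)] comonotone_maximiser[of v I]
    perm_orbit_coord_space[OF assms] perm_orbit_eq[OF assms(2)]
  by (auto simp: normal_cone_def comonotone_cone_def)

section \<open>Normal fans of convex hulls of finite sets\<close>

text \<open>The inequality between \<open>y \<bullet> z\<close> and \<open>y \<bullet> x\<close>
  cuts out a half-space in \<open>x\<close> for fixed \<open>z\<close> and in \<open>z\<close> for
  fixed \<open>x\<close>, so it passes to the two hulls one after the other.\<close>

lemma normal_cone_convex_hull:
  "normal_cone I (convex hull V) (convex hull S) = normal_cone I V S"
proof
  show "normal_cone I (convex hull V) (convex hull S) \<subseteq> normal_cone I V S"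
    using hull_subset[of V convex] hull_subset[of S convex] by (auto simp: normal_cone_def)
next
  show "normal_cone I V S \<subseteq> normal_cone I (convex hull V) (convex hull S)"
  proof
    fix y assume y: "y \<in> normal_cone I V S"
    have "convex hull S \<subseteq> {x. y \<bullet> z \<le> y \<bullet> x}" if "z \<in> V" for z
      using y that convex_halfspace_ge[of "y \<bullet> z" y]
      by (intro hull_minimal) (auto simp: normal_cone_def)
    then have "convex hull V \<subseteq> {z. y \<bullet> z \<le> y \<bullet> x}" if "x \<in> convex hull S" for x
      using that convex_halfspace_le[of y "y \<bullet> x"] by (intro hull_minimal) auto
    then show "y \<in> normal_cone I (convex hull V) (convex hull S)"
      using y by (auto simp: normal_cone_def)
  qed
qed

text \<open>Faces are exposed by functionals of the ambient space, whereas the fan lives in the dual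
  of the coordinate space. Erasing the coordinates outside \<open>I\<close> mediates between the
  two.\<close>

lemma coord_space_projection:
  fixes a :: "real ^ 'i::finite"
  obtains w where "w \<in> coord_space I" "\<forall>x\<in>coord_space I. w \<bullet> x = a \<bullet> x"
proof
  let ?w = "\<chi> i. if i \<in> I then a $ i else 0"
  show "?w \<in> coord_space I" by (simp add: coord_space_def)
  show "\<forall>x\<in>coord_space I. ?w \<bullet> x = a \<bullet> x"
    unfolding inner_vec_def by (intro ballI sum.cong) (auto simp: coord_space_def)
qed

text \<open>Every face of a polytope is exposed, hence is spanned by the points of \<open>V\<close>
  that maximise some functional \<open>w\<close>.\<close>

lemma face_convex_hull_iff:
  fixes V :: "(real ^ 'i::finite) set"
  assumes "finite V" "V \<noteq> {}" "V \<subseteq> coord_space I"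
  shows "F face_of convex hull V \<and> F \<noteq> {} \<longleftrightarrow>
    (\<exists>w \<in> coord_space I. F = convex hull {v \<in> V. w \<in> normal_cone I V {v}})"
proof
  assume F: "F face_of convex hull V \<and> F \<noteq> {}"
  then have "F exposed_face_of convex hull V"
    using assms(1) by (simp add: exposed_face_of_polyhedron polyhedron_convex_hull)
  then obtain a b where ab: "convex hull V \<subseteq> {x. a \<bullet> x \<le> b}" "F = convex hull V \<inter> {x. a \<bullet> x = b}"
    by (auto simp: exposed_face_of_def)
  obtain w where w: "w \<in> coord_space I" "\<forall>x\<in>coord_space I. w \<bullet> x = a \<bullet> x"
    by (rule coord_space_projection)
  \<comment> \<open>\<open>S\<close> is only some subset of \<open>V\<close> that spans
    \<open>F\<close>. It is compared with the set \<open>?M\<close> of all maximisers by squeezing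
    \<open>?M\<close> between \<open>S\<close> and \<open>F\<close>.\<close>
  obtain S where S: "S \<subseteq> V" "F = convex hull S"
    using F assms(1) by (metis face_of_convex_hull_subset finite_imp_compact)
  have "S \<noteq> {}" using F S by auto
  have V: "V \<subseteq> convex hull V" by (rule hull_subset)
  have S_b: "w \<bullet> v = b" if "v \<in> S" for v
  proof -
    have "v \<in> F" using that S(2) hull_subset[of S convex] by auto
    then show ?thesis using that S(1) w(2) assms(3) ab(2) by auto
  qed
  have V_b: "w \<bullet> v \<le> b" if "v \<in> V" for v
  proof -
    have "a \<bullet> v \<le> b" using that V ab(1) by auto
    then show ?thesis using that w(2) assms(3) by auto
  qed
  let ?M = "{v \<in> V. w \<in> normal_cone I V {v}}"
  have "S \<subseteq> ?M"
    using S(1) S_b V_b w(1) by (auto simp: normal_cone_def)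
  moreover have "?M \<subseteq> F"
  proof
    fix v assume v: "v \<in> ?M"
    obtain s where "s \<in> S" using \<open>S \<noteq> {}\<close> by auto
    then have "b \<le> w \<bullet> v" using v S(1) S_b by (auto simp: normal_cone_def)
    then have "a \<bullet> v = b" using v V_b w(2) assms(3) by force
    then show "v \<in> F" using v V ab(2) by auto
  qed
  moreover have "convex F" using S by simp
  ultimately have "F = convex hull ?M"
    using S(2) by (metis hull_minimal hull_mono subset_antisym)
  with w(1) show "\<exists>w \<in> coord_space I. F = convex hull {v \<in> V. w \<in> normal_cone I V {v}}" by blast
next
  assume "\<exists>w \<in> coord_space I. F = convex hull {v \<in> V. w \<in> normal_cone I V {v}}"
  then obtain w where w: "w \<in> coord_space I" "F = convex hull {v \<in> V. w \<in> normal_cone I V {v}}"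
    by blast
  let ?M = "{v \<in> V. w \<in> normal_cone I V {v}}" and ?b = "Max ((\<bullet>) w ` V)"
  have "?b \<in> (\<bullet>) w ` V" using assms by (intro Max_in) auto
  then obtain m where m: "m \<in> V" "w \<bullet> m = ?b" by auto
  have max: "w \<bullet> v \<le> ?b" if "v \<in> V" for v using that assms(1) by auto
  have M: "?M = {v \<in> V. w \<bullet> v = ?b}"
    using m max w(1) by (auto simp: normal_cone_def intro!: antisym)
  have ne: "?M \<noteq> {}"
    unfolding M using m by blast
  let ?G = "convex hull V \<inter> {x. w \<bullet> x = ?b}"
  have le: "convex hull V \<subseteq> {x. w \<bullet> x \<le> ?b}"
    using assms(1) by (intro hull_minimal convex_halfspace_le) auto
  then have G: "?G face_of convex hull V"
    by (intro face_of_Int_supporting_hyperplane_le) auto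
  then obtain S where S: "S \<subseteq> V" "?G = convex hull S"
    using assms(1) by (metis face_of_convex_hull_subset finite_imp_compact)
  have "S \<subseteq> ?G" using S(2) hull_subset[of S convex] by simp
  then have "S \<subseteq> ?M" using M S(1) by auto
  moreover have "?M \<subseteq> ?G"
    using M hull_subset[of V convex] by auto
  moreover have "convex ?G" using S by simp
  ultimately have "?G = F"
    using S(2) w(2) by (metis (no_types, lifting) hull_minimal hull_mono subset_antisym)
  moreover have "F \<noteq> {}" using w(2) ne by simp
  ultimately show "F face_of convex hull V \<and> F \<noteq> {}"
    using G by metis
qed

text \<open>The fan is now indexed by functionals instead of faces. The cone listed for
  \<open>w\<close> is the smallest cone of the fan that contains \<open>w\<close>.\<close>

lemma normal_fan_convex_hull:
  fixes V :: "(real ^ 'i::finite) set"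
  assumes "finite V" "V \<noteq> {}" "V \<subseteq> coord_space I"
  shows "normal_fan I (convex hull V)
    = {normal_cone I V {v \<in> V. w \<in> normal_cone I V {v}} | w. w \<in> coord_space I}"
proof -
  have "normal_fan I (convex hull V) = {normal_cone I (convex hull V) F | F.
      \<exists>w\<in>coord_space I. F = convex hull {v \<in> V. w \<in> normal_cone I V {v}}}"
    unfolding normal_fan_def by (simp only: face_convex_hull_iff[OF assms])
  also have "\<dots> = {normal_cone I (convex hull V) (convex hull {v \<in> V. w \<in> normal_cone I V {v}})
      | w. w \<in> coord_space I}"
    by blast
  finally show ?thesis
    by (simp only: normal_cone_convex_hull)
qed

section \<open>Positions and the fundamental chamber\<close>

text \<open>The predecessors of an earlier element form a proper subset of those of a later one;
  totality of \<open>r\<close> gives the converse.\<close>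

lemma position_less_iff:
  assumes "linear_order_on I r" "i \<in> I" "j \<in> I"
  shows "position I r i < position I r j \<longleftrightarrow> (i, j) \<in> r \<and> i \<noteq> j"
proof -
  have tr: "trans r" and asym: "antisym r" and tot: "total_on I r"
    using assms(1) by (auto simp: linear_order_on_def partial_order_on_def preorder_on_def)
  have less: "position I r i < position I r j" if "(i, j) \<in> r" "i \<noteq> j" "i \<in> I" for i j
    unfolding position_def
  proof (intro psubset_card_mono psubsetI subsetI)
    fix k assume "k \<in> {k \<in> I. (k, i) \<in> r \<and> k \<noteq> i}"
    then show "k \<in> {k \<in> I. (k, j) \<in> r \<and> k \<noteq> j}"
      using that tr asym by (auto dest: transD antisymD)
  qed (use that in auto)
  show ?thesis
    using less[of i j] less[of j i] tot assms(2,3) unfolding total_on_def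
    by (metis less_asym less_irrefl)
qed

lemma bij_betw_position:
  assumes "linear_order_on I r"
  shows "bij_betw (position I r) I {..<card I}"
proof -
  have "inj_on (position I r) I"
  proof (rule inj_onI)
    fix i j assume ij: "i \<in> I" "j \<in> I" "position I r i = position I r j"
    have "total_on I r" using assms by (auto simp: linear_order_on_def)
    then show "i = j"
      using ij position_less_iff[OF assms ij(1,2)] position_less_iff[OF assms ij(2,1)]
      unfolding total_on_def by auto
  qed
  moreover have "position I r ` I \<subseteq> {..<card I}"
    unfolding position_def by (auto intro!: psubset_card_mono)
  ultimately show ?thesis
    by (simp add: bij_betw_def card_image card_subset_eq)
qed

lemma position_less_card:
  assumes "linear_order_on I r" "i \<in> I"
  shows "position I r i < card I"
  using bij_betw_apply[OF bij_betw_position[OF assms(1)] assms(2)] by simp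

lemma position_surj:
  assumes "linear_order_on I r" "m < card I"
  obtains i where "i \<in> I" "position I r i = m"
proof -
  have "m \<in> position I r ` I"
    using bij_betw_imp_surj_on[OF bij_betw_position[OF assms(1)]] assms(2) by simp
  then show thesis using that by auto
qed

lemma chamber_iff_position:
  assumes "linear_order_on I r"
  shows "x \<in> chamber I r \<longleftrightarrow> x \<in> coord_space I \<and>
    (\<forall>i\<in>I. \<forall>j\<in>I. position I r i < position I r j \<longrightarrow> x $ j \<le> x $ i)"
  unfolding chamber_def using position_less_iff[OF assms] by blast

lemma chamber_position_less:
  assumes "linear_order_on I r" "x \<in> chamber I r" "i \<in> I" "j \<in> I" "x $ j < x $ i"
  shows "position I r i < position I r j"
proof -
  have "i = j" if "position I r i = position I r j"
    using bij_betw_imp_inj_on[OF bij_betw_position[OF assms(1)]] assms(3,4) that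
    by (auto dest: inj_onD)
  then show ?thesis
    using assms by (metis chamber_iff_position less_asym less_irrefl linorder_neqE not_less)
qed

lemma chamber_comonotone:
  assumes "linear_order_on I r" "x \<in> chamber I r" "y \<in> chamber I r"
  shows "comonotone I x y"
  unfolding comonotone_def
  using assms chamber_position_less[OF assms(1,2)] chamber_iff_position[OF assms(1)] by blast

text \<open>Two points of the chamber are sorted alike, hence comonotone. With
  \<open>chamber_representative\<close> this makes the chamber a fundamental domain for the
  action.\<close>

lemma chamber_perm_orbit_unique:
  assumes "linear_order_on I r" "x \<in> chamber I r" "y \<in> chamber I r" "y \<in> perm_orbit I x"
  shows "y = x"
  using assms chamber_comonotone by (intro comonotone_perm_orbit_eq[of x I]) (auto simp: chamber_def)

text \<open>The sign makes the coordinates decrease along \<open>r\<close>. For a linear order they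
  are distinct on \<open>I\<close>, so the vector lies on no wall of the chamber.\<close>

definition position_weight :: "'i::finite set \<Rightarrow> 'i rel \<Rightarrow> real ^ 'i" where
  "position_weight I r = (\<chi> i. if i \<in> I then - real (position I r i) else 0)"

lemma position_weight_coord_space: "position_weight I r \<in> coord_space I"
  by (simp add: position_weight_def coord_space_def)

text \<open>The weight has no ties on \<open>I\<close>, so being comonotone with it fixes the weak
  order of every pair of coordinates.\<close>

lemma comonotone_position_weight_iff:
  assumes "linear_order_on I r" "v \<in> coord_space I"
  shows "comonotone I v (position_weight I r) \<longleftrightarrow> v \<in> chamber I r"
proof -
  have "comonotone I v (position_weight I r) \<longleftrightarrow>
      (\<forall>i\<in>I. \<forall>j\<in>I. v $ j < v $ i \<longrightarrow> position I r i \<le> position I r j)"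
    by (simp add: comonotone_def position_weight_def)
  also have "\<dots> \<longleftrightarrow> v \<in> chamber I r"
    using assms(2) unfolding chamber_iff_position[OF assms(1)] by (meson not_less)
  finally show ?thesis .
qed

text \<open>A point of the orbit that maximises the weight is comonotone with it, hence
  sorted.\<close>

lemma chamber_representative:
  assumes "linear_order_on I r" "p \<in> coord_space I"
  obtains x where "x \<in> chamber I r" "x \<in> perm_orbit I p"
proof -
  obtain u where u: "u \<in> perm_orbit I p"
    "\<forall>u'\<in>perm_orbit I p. position_weight I r \<bullet> u' \<le> position_weight I r \<bullet> u"
    by (rule perm_orbit_maximiser)
  then have "comonotone I u (position_weight I r)" by (rule maximiser_comonotone)
  then have "u \<in> chamber I r"
    using comonotone_position_weight_iff[OF assms(1)] perm_orbit_coord_space[OF assms(2) u(1)] by blast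
  with u(1) show thesis using that by blast
qed

section \<open>Compositions as sets of partial sums\<close>

text \<open>The empty sum and the total are both included. Thus compositions of \<open>n\<close>
  correspond to the subsets of \<open>{..n}\<close> that contain \<open>0\<close> and
  \<open>n\<close>.\<close>

definition cuts :: "nat list \<Rightarrow> nat set" where
  "cuts \<alpha> = (\<lambda>k. sum_list (take k \<alpha>)) ` {..length \<alpha>}"

lemma cuts_Nil [simp]: "cuts [] = {0}"
  by (simp add: cuts_def)

lemma cuts_Cons: "cuts (a # \<alpha>) = insert 0 ((+) a ` cuts \<alpha>)"
  by (simp add: cuts_def atMost_Suc_eq_insert_0 image_image)

lemma zero_in_cuts [simp]: "0 \<in> cuts \<alpha>"
  by (cases \<alpha>) (simp_all add: cuts_Cons)

lemma hd_in_cuts: "a \<in> cuts (a # \<alpha>)"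
  using image_eqI[of a "(+) a" 0 "cuts \<alpha>"] by (simp add: cuts_Cons)

lemma cuts_snoc: "cuts (\<alpha> @ [a]) = insert (sum_list \<alpha> + a) (cuts \<alpha>)"
  by (induction \<alpha>) (auto simp: cuts_Cons)

lemma cuts_le_sum_list: "s \<in> cuts \<alpha> \<Longrightarrow> s \<le> sum_list \<alpha>"
  by (induction \<alpha> arbitrary: s) (auto simp: cuts_Cons)

lemma sum_list_in_cuts: "sum_list \<alpha> \<in> cuts \<alpha>"
  by (induction \<alpha>) (auto simp: cuts_Cons)

text \<open>Since all parts are positive, the first part is the least nonzero cut. Dropping
  \<open>0\<close> and shifting by that part leaves the cuts of the tail.\<close>

lemma cuts_inject:
  assumes "\<forall>a\<in>set \<alpha>. 0 < a" "\<forall>b\<in>set \<beta>. 0 < b" "cuts \<alpha> = cuts \<beta>"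
  shows "\<alpha> = \<beta>"
  using assms
proof (induction \<alpha> arbitrary: \<beta>)
  case Nil
  show ?case
  proof (cases \<beta>)
    case (Cons b \<beta>')
    then have "b = 0" using Nil.prems(3) hd_in_cuts[of b \<beta>'] by (metis cuts_Nil singletonD)
    with Nil Cons show ?thesis by auto
  qed simp
next
  case (Cons a \<alpha>)
  show ?case
  proof (cases \<beta>)
    case Nil
    then have "a = 0" using Cons.prems(3) hd_in_cuts[of a \<alpha>] by (metis cuts_Nil singletonD)
    with Cons.prems show ?thesis by auto
  next
    case (Cons b \<beta>')
    have eq: "insert 0 ((+) a ` cuts \<alpha>) = insert 0 ((+) b ` cuts \<beta>')"
      using Cons.prems(3) Cons by (simp add: cuts_Cons)
    have pos: "0 < a" "0 < b" using Cons.prems Cons by auto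
    have "a \<in> insert 0 ((+) b ` cuts \<beta>')" "b \<in> insert 0 ((+) a ` cuts \<alpha>)"
      using hd_in_cuts[of a \<alpha>] hd_in_cuts[of b \<beta>'] eq by (simp_all add: cuts_Cons)
    then have "a = b" using pos by auto
    \<comment> \<open>Positivity keeps \<open>0\<close> out of both shifted sets, so it can be
      cancelled from the equation \<open>eq\<close>.\<close>
    have "(+) a ` cuts \<alpha> = (+) a ` cuts \<beta>'"
    proof -
      have "0 \<notin> (+) a ` cuts \<alpha>" "0 \<notin> (+) a ` cuts \<beta>'" using pos by auto
      then show ?thesis using eq \<open>a = b\<close> by (metis insert_ident)
    qed
    then have "cuts \<alpha> = cuts \<beta>'" by (simp add: inj_image_eq_iff)
    then have "\<alpha> = \<beta>'" using Cons.IH Cons.prems Cons by simp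
    with \<open>a = b\<close> Cons show ?thesis by simp
  qed
qed

text \<open>Strong induction that removes the top element \<open>n\<close>: the next largest element
  \<open>?m\<close> is the total of a shorter composition, and \<open>n - ?m\<close> becomes the
  last part.\<close>

lemma composition_with_cuts:
  assumes "S \<subseteq> {..n}" "0 \<in> S" "n \<in> S"
  obtains \<alpha> where "is_composition n \<alpha>" "cuts \<alpha> = S"
proof -
  have "\<exists>\<alpha>. is_composition n \<alpha> \<and> cuts \<alpha> = S"
    using assms
  proof (induction n arbitrary: S rule: less_induct)
    case (less n)
    show ?case
    proof (cases "n = 0")
      case True
      then have "S = {0}" using less.prems by auto
      with True show ?thesis by (intro exI[of _ "[]"]) (simp add: is_composition_def)
    next
      case False
      let ?S = "S - {n}" and ?m = "Max (S - {n})"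
      have fin: "finite ?S" using less.prems(1) finite_subset by blast
      have "0 \<in> ?S" using less.prems False by simp
      then have m: "?m \<in> ?S" using Max_in[OF fin] by blast
      then have "?m \<noteq> n" "?m \<le> n" using less.prems(1) by auto
      then have mn: "?m < n" by simp
      have "?S \<subseteq> {..?m}" using Max_ge[OF fin] by blast
      then obtain \<alpha> where \<alpha>: "is_composition ?m \<alpha>" "cuts \<alpha> = ?S"
        using less.IH[OF mn _ \<open>0 \<in> ?S\<close> m] by blast
      have "is_composition n (\<alpha> @ [n - ?m])"
        using \<alpha>(1) mn by (auto simp: is_composition_def)
      moreover have "cuts (\<alpha> @ [n - ?m]) = S"
        using \<alpha> mn less.prems(3) by (auto simp: cuts_snoc is_composition_def)
      ultimately show ?thesis by blast
    qed
  qed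
  then show thesis using that by blast
qed

lemma sum_list_take_mono: "k \<le> l \<Longrightarrow> sum_list (take k \<alpha>) \<le> sum_list (take l (\<alpha> :: nat list))"
  by (metis le_add1 le_add_diff_inverse sum_list_append take_add)

text \<open>The first partial sum above \<open>m\<close> ends the block. Its index is a successor
  because the empty sum is \<open>0\<close>.\<close>

lemma mem_block:
  fixes m :: nat
  assumes "m < sum_list \<alpha>"
  obtains k where "k < length \<alpha>" "sum_list (take k \<alpha>) \<le> m" "m < sum_list (take (Suc k) \<alpha>)"
proof -
  define k where "k = (LEAST k. m < sum_list (take k \<alpha>))"
  have k: "m < sum_list (take k \<alpha>)"
    unfolding k_def by (rule LeastI[of _ "length \<alpha>"]) (use assms in simp)
  moreover have "k \<le> length \<alpha>"
    unfolding k_def by (rule Least_le) (use assms in simp)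
  moreover obtain k' where k': "k = Suc k'"
    using k by (cases k) auto
  moreover have "\<not> m < sum_list (take k' \<alpha>)"
    using not_less_Least[of k' "\<lambda>k. m < sum_list (take k \<alpha>)"] k' by (simp flip: k_def)
  ultimately show thesis
    by (intro that[of k']) auto
qed

section \<open>Faces of the chamber and their relative interiors\<close>

text \<open>Positions count from 0, so a cut \<open>s\<close> is the boundary between the positions
  \<open>s - 1\<close> and \<open>s\<close>; hence one strict and one weak inequality.\<close>

definition separated :: "nat set \<Rightarrow> nat \<Rightarrow> nat \<Rightarrow> bool" where
  "separated S a b \<longleftrightarrow> (\<exists>s\<in>S. a < s \<and> s \<le> b)"

lemma separated_imp_less: "separated S a b \<Longrightarrow> a < b"
  by (auto simp: separated_def)

text \<open>A block is an interval of positions whose two ends are consecutive partial sums. Both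
  directions are excluded because either index may come first.\<close>

lemma same_block_iff:
  assumes "linear_order_on I r" "is_composition (card I) \<alpha>" "i \<in> I" "j \<in> I"
  shows "(\<exists>k < length \<alpha>. i \<in> block I r \<alpha> k \<and> j \<in> block I r \<alpha> k) \<longleftrightarrow>
    \<not> separated (cuts \<alpha>) (position I r i) (position I r j) \<and>
    \<not> separated (cuts \<alpha>) (position I r j) (position I r i)"
proof -
  have not_sep: "\<not> separated (cuts \<alpha>) (position I r i) (position I r j)"
    if "i \<in> block I r \<alpha> k" "j \<in> block I r \<alpha> k" for i j k
  proof
    assume "separated (cuts \<alpha>) (position I r i) (position I r j)"
    then obtain l where l: "position I r i < sum_list (take l \<alpha>)" "sum_list (take l \<alpha>) \<le> position I r j"
      by (auto simp: separated_def cuts_def)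
    then show False
      using that sum_list_take_mono[of l k \<alpha>] sum_list_take_mono[of "Suc k" l \<alpha>]
      by (cases "l \<le> k") (auto simp: block_def)
  qed
  have "position I r i < sum_list \<alpha>"
    using position_less_card[OF assms(1,3)] assms(2) by (simp add: is_composition_def)
  then obtain k where k: "k < length \<alpha>" "i \<in> block I r \<alpha> k"
    using assms(3) mem_block[of "position I r i" \<alpha>] by (auto simp: block_def)
  have "j \<in> block I r \<alpha> k"
    if "\<not> separated (cuts \<alpha>) (position I r i) (position I r j)"
      "\<not> separated (cuts \<alpha>) (position I r j) (position I r i)"
  proof -
    have "sum_list (take k \<alpha>) \<in> cuts \<alpha>" "sum_list (take (Suc k) \<alpha>) \<in> cuts \<alpha>"
      using k(1) by (auto simp: cuts_def simp del: take_Suc)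
    then show ?thesis
      using that k(2) assms(4) by (auto simp: separated_def block_def)
  qed
  then show ?thesis using k not_sep by blast
qed

text \<open>Equality within blocks is restated through strict drops. In the chamber a drop runs from
  an earlier to a later position, so only one direction of separation can occur.\<close>

lemma chamber_face_iff:
  assumes "linear_order_on I r" "is_composition (card I) \<alpha>"
  shows "x \<in> chamber_face I r \<alpha> \<longleftrightarrow> x \<in> chamber I r \<and>
    (\<forall>i\<in>I. \<forall>j\<in>I. x $ j < x $ i \<longrightarrow> separated (cuts \<alpha>) (position I r i) (position I r j))"
proof (cases "x \<in> chamber I r")
  case True
  have "block I r \<alpha> k \<subseteq> I" for k by (auto simp: block_def)
  then have "x \<in> chamber_face I r \<alpha> \<longleftrightarrow> (\<forall>i\<in>I. \<forall>j\<in>I.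
      (\<exists>k < length \<alpha>. i \<in> block I r \<alpha> k \<and> j \<in> block I r \<alpha> k) \<longrightarrow> x $ i = x $ j)"
    using True unfolding chamber_face_def mem_Collect_eq by blast
  also have "\<dots> \<longleftrightarrow> (\<forall>i\<in>I. \<forall>j\<in>I.
      \<not> separated (cuts \<alpha>) (position I r i) (position I r j) \<and>
      \<not> separated (cuts \<alpha>) (position I r j) (position I r i) \<longrightarrow> x $ i = x $ j)"
    using same_block_iff[OF assms] by simp
  also have "\<dots> \<longleftrightarrow> (\<forall>i\<in>I. \<forall>j\<in>I. x $ j < x $ i \<longrightarrow>
      separated (cuts \<alpha>) (position I r i) (position I r j))"
    (is "?L \<longleftrightarrow> ?R")
  proof
    assume L: ?L
    show ?R
    proof (intro ballI impI)
      fix i j assume ij: "i \<in> I" "j \<in> I" "x $ j < x $ i"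
      then have "position I r i < position I r j"
        using chamber_position_less[OF assms(1) True] by blast
      then have "\<not> separated (cuts \<alpha>) (position I r j) (position I r i)"
        using separated_imp_less by (meson less_asym)
      then show "separated (cuts \<alpha>) (position I r i) (position I r j)"
        using L ij by fastforce
    qed
  next
    assume ?R
    then show ?L by (meson linorder_neqE)
  qed
  finally show ?thesis using True by simp
qed (simp add: chamber_face_def)

lemma convex_chamber: "convex (chamber I r)"
  unfolding convex_def chamber_def coord_space_def by (auto intro!: add_mono mult_left_mono)

lemma convex_chamber_face: "convex (chamber_face I r \<alpha>)"
proof (rule convexI)
  fix x y and u v :: real
  assume xy: "x \<in> chamber_face I r \<alpha>" "y \<in> chamber_face I r \<alpha>"
    and uv: "0 \<le> u" "0 \<le> v" "u + v = 1"
  have "x \<in> chamber I r" "y \<in> chamber I r" using xy by (auto simp: chamber_face_def)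
  with uv have "u *\<^sub>R x + v *\<^sub>R y \<in> chamber I r"
    by (intro convexD[OF convex_chamber])
  moreover have "(u *\<^sub>R x + v *\<^sub>R y) $ i = (u *\<^sub>R x + v *\<^sub>R y) $ j"
    if "k < length \<alpha>" "i \<in> block I r \<alpha> k" "j \<in> block I r \<alpha> k" for i j k
  proof -
    have "x $ i = x $ j" "y $ i = y $ j"
      using xy that unfolding chamber_face_def mem_Collect_eq by blast+
    then show ?thesis by simp
  qed
  ultimately show "u *\<^sub>R x + v *\<^sub>R y \<in> chamber_face I r \<alpha>"
    unfolding chamber_face_def by blast
qed

lemma chamber_face_strict_point:
  assumes "linear_order_on I r" "is_composition (card I) \<alpha>"
  obtains z where "z \<in> chamber_face I r \<alpha>"
    "\<And>i j. i \<in> I \<Longrightarrow> j \<in> I \<Longrightarrow> separated (cuts \<alpha>) (position I r i) (position I r j) \<Longrightarrow> z $ j < z $ i"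
proof
  have fin: "finite (cuts \<alpha>)" by (simp add: cuts_def)
  \<comment> \<open>\<open>f\<close> counts the cuts up to a position. It is constant on each block
    and jumps at each cut, so its negative is a point of the face with every permitted drop
    strict.\<close>
  define f where "f a = card {s \<in> cuts \<alpha>. s \<le> a}" for a
  let ?z = "\<chi> i. if i \<in> I then - real (f (position I r i)) else 0"
  have mono: "f a \<le> f b" if "a \<le> b" for a b
    unfolding f_def using that fin by (intro card_mono) auto
  have f_less: "f a < f b \<longleftrightarrow> separated (cuts \<alpha>) a b" for a b
  proof
    assume less: "f a < f b"
    show "separated (cuts \<alpha>) a b"
    proof (rule ccontr)
      assume "\<not> separated (cuts \<alpha>) a b"
      then have "{s \<in> cuts \<alpha>. s \<le> b} \<subseteq> {s \<in> cuts \<alpha>. s \<le> a}"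
        by (auto simp: separated_def not_less)
      then have "f b \<le> f a" unfolding f_def using fin by (intro card_mono) auto
      with less show False by simp
    qed
  next
    assume sep: "separated (cuts \<alpha>) a b"
    then obtain s where "s \<in> cuts \<alpha>" "a < s" "s \<le> b" by (auto simp: separated_def)
    then have "{s \<in> cuts \<alpha>. s \<le> a} \<subset> {s \<in> cuts \<alpha>. s \<le> b}"
      using leD by (intro psubsetI) auto
    then show "f a < f b" unfolding f_def using fin by (intro psubset_card_mono) auto
  qed
  show "?z \<in> chamber_face I r \<alpha>"
    unfolding chamber_face_iff[OF assms] chamber_iff_position[OF assms(1)]
    using f_less mono by (auto simp: coord_space_def)
  show "?z $ j < ?z $ i" if "i \<in> I" "j \<in> I" "separated (cuts \<alpha>) (position I r i) (position I r j)" for i j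
    using that f_less by simp
qed

text \<open>By the prolongation criterion, \<open>x\<close> is relatively interior iff every segment
  from a point of the face to \<open>x\<close> extends a little beyond \<open>x\<close> within the
  face.\<close>

lemma rel_interior_chamber_face:
  assumes "linear_order_on I r" "is_composition (card I) \<alpha>"
  shows "x \<in> rel_interior (chamber_face I r \<alpha>) \<longleftrightarrow> x \<in> chamber I r \<and>
    (\<forall>i\<in>I. \<forall>j\<in>I. x $ j < x $ i \<longleftrightarrow> separated (cuts \<alpha>) (position I r i) (position I r j))"
  (is "?L \<longleftrightarrow> _ \<and> ?R")
proof -
  let ?C = "chamber_face I r \<alpha>"
  note C_iff = chamber_face_iff[OF assms]
  obtain z0 where z0: "z0 \<in> ?C" "\<And>i j. i \<in> I \<Longrightarrow> j \<in> I \<Longrightarrow>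
      separated (cuts \<alpha>) (position I r i) (position I r j) \<Longrightarrow> z0 $ j < z0 $ i"
    using chamber_face_strict_point[OF assms] by blast
  have L_iff: "?L \<longleftrightarrow> (\<forall>z\<in>?C. \<exists>e. e > 1 \<and> (1 - e) *\<^sub>R z + e *\<^sub>R x \<in> ?C)"
    using convex_rel_interior_iff[OF convex_chamber_face] z0(1) by blast
  show ?thesis
  proof
    assume L: ?L
    then have xC: "x \<in> ?C" using rel_interior_subset by blast
    \<comment> \<open>Prolonging from the strict point \<open>z0\<close> shows that \<open>x\<close>
      must drop wherever \<open>z0\<close> does: a tie of \<open>x\<close> there would be reversed
      beyond \<open>x\<close>.\<close>
    obtain e where e: "e > 1" "(1 - e) *\<^sub>R z0 + e *\<^sub>R x \<in> ?C"
      using L L_iff z0(1) by blast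
    have "x $ j < x $ i"
      if ij: "i \<in> I" "j \<in> I" and sep: "separated (cuts \<alpha>) (position I r i) (position I r j)" for i j
    proof -
      have "((1 - e) *\<^sub>R z0 + e *\<^sub>R x) $ j \<le> ((1 - e) *\<^sub>R z0 + e *\<^sub>R x) $ i"
        using e(2) ij separated_imp_less[OF sep] unfolding C_iff chamber_iff_position[OF assms(1)] by blast
      then have "(e - 1) * (z0 $ i - z0 $ j) \<le> e * (x $ i - x $ j)"
        by (simp add: algebra_simps)
      moreover have "0 < (e - 1) * (z0 $ i - z0 $ j)"
        using e(1) z0(2)[OF ij sep] by simp
      ultimately show ?thesis
        using e(1) by (smt (verit) zero_less_mult_iff)
    qed
    then show "x \<in> chamber I r \<and> ?R" using xC C_iff by blast
  next
    assume R: "x \<in> chamber I r \<and> ?R"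
    show ?L
      unfolding L_iff
    proof
      fix z assume z: "z \<in> ?C"
      \<comment> \<open>\<open>w t\<close> lies beyond \<open>x\<close> on the ray from
        \<open>z\<close>. For small \<open>t\<close> the finitely many strict inequalities of
        \<open>x\<close> survive, and the ties of \<open>x\<close> are also ties of
        \<open>z\<close>.\<close>
      define w where "w t = (1 - (1 + t)) *\<^sub>R z + (1 + t) *\<^sub>R x" for t :: real
      have w_diff: "w t $ i - w t $ j = (x $ i - x $ j) + t * ((x $ i - x $ j) - (z $ i - z $ j))" for t i j
        by (simp add: w_def algebra_simps)
      have "\<forall>\<^sub>F t in at_right 0. x $ j < x $ i \<longrightarrow> w t $ j < w t $ i" for i j
      proof (cases "x $ j < x $ i")
        case True
        have "((\<lambda>t. w t $ i - w t $ j) \<longlongrightarrow> x $ i - x $ j) (at_right 0)"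
          unfolding w_diff by (auto intro!: tendsto_eq_intros)
        then have "\<forall>\<^sub>F t in at_right 0. 0 < w t $ i - w t $ j"
          using True by (intro order_tendstoD(1)) auto
        then show ?thesis by eventually_elim simp
      qed simp
      then have "\<forall>\<^sub>F t in at_right 0. 0 < t \<and> (\<forall>i j. x $ j < x $ i \<longrightarrow> w t $ j < w t $ i)"
        by (intro eventually_conj eventually_all_finite eventually_at_right_less)
      then obtain t where t: "0 < t" "\<And>i j. x $ j < x $ i \<Longrightarrow> w t $ j < w t $ i"
        using eventually_happens'[OF trivial_limit_at_right_real] by blast
      have eq: "w t $ i = w t $ j" if "i \<in> I" "j \<in> I" "x $ i = x $ j" for i j
      proof -
        have "\<not> separated (cuts \<alpha>) (position I r i) (position I r j)"
          "\<not> separated (cuts \<alpha>) (position I r j) (position I r i)"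
          using R that by fastforce+
        then have "z $ i = z $ j"
          using z that unfolding C_iff by (meson linorder_neqE)
        then show ?thesis using w_diff[of t i j] that by simp
      qed
      have le: "w t $ j \<le> w t $ i" if "i \<in> I" "j \<in> I" "x $ j \<le> x $ i" for i j
        using that t(2)[of j i] eq[of i j] by (cases "x $ j < x $ i") auto
      have "x \<in> coord_space I" "z \<in> coord_space I"
        using R z by (auto simp: C_iff chamber_def)
      then have "w t \<in> coord_space I" by (auto simp: w_def coord_space_def)
      then have "w t \<in> chamber I r"
        using R le by (simp add: chamber_iff_position[OF assms(1)])
      moreover have "separated (cuts \<alpha>) (position I r i) (position I r j)"
        if "i \<in> I" "j \<in> I" "w t $ j < w t $ i" for i j
        using that R le[of j i] by (meson not_less)
      ultimately have "w t \<in> ?C" unfolding C_iff by blast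
      then show "\<exists>e. e > 1 \<and> (1 - e) *\<^sub>R z + e *\<^sub>R x \<in> ?C"
        using t(1) unfolding w_def by (intro exI[of _ "1 + t"]) simp
    qed
  qed
qed

section \<open>Compositions of points and of orbit polytopes\<close>

text \<open>The only cut that can separate the adjacent positions \<open>s - 1\<close> and
  \<open>s\<close> is \<open>s\<close> itself. The extreme values \<open>0\<close> and
  \<open>n\<close> are cuts of every composition of \<open>n\<close>.\<close>

lemma cuts_subset_if_separated:
  assumes "is_composition n \<alpha>" "is_composition n \<beta>"
    and "\<And>a b. a < n \<Longrightarrow> b < n \<Longrightarrow> separated (cuts \<alpha>) a b \<Longrightarrow> separated (cuts \<beta>) a b"
  shows "cuts \<alpha> \<subseteq> cuts \<beta>"
proof
  fix s assume s: "s \<in> cuts \<alpha>"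
  then have "s \<le> n" using assms(1) cuts_le_sum_list by (auto simp: is_composition_def)
  then consider "s = 0" | "s = n" | "0 < s" "s < n" by linarith
  then show "s \<in> cuts \<beta>"
  proof cases
    case 2
    then show ?thesis using assms(2) sum_list_in_cuts by (auto simp: is_composition_def)
  next
    case 3
    then have "separated (cuts \<alpha>) (s - 1) s" using s by (auto simp: separated_def)
    then have "separated (cuts \<beta>) (s - 1) s" using assms(3) 3 by simp
    then obtain t where "t \<in> cuts \<beta>" "s - 1 < t" "t \<le> s" by (auto simp: separated_def)
    moreover have "t = s" using \<open>s - 1 < t\<close> \<open>t \<le> s\<close> by linarith
    ultimately show ?thesis by simp
  qed simp
qed

lemma composition_eq_if_separated:
  assumes "is_composition n \<alpha>" "is_composition n \<beta>"
    and "\<And>a b. a < n \<Longrightarrow> b < n \<Longrightarrow> separated (cuts \<alpha>) a b \<longleftrightarrow> separated (cuts \<beta>) a b"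
  shows "\<alpha> = \<beta>"
proof (rule cuts_inject)
  show "cuts \<alpha> = cuts \<beta>"
    using assms cuts_subset_if_separated[of n \<alpha> \<beta>] cuts_subset_if_separated[of n \<beta> \<alpha>] by blast
qed (use assms in \<open>auto simp: is_composition_def\<close>)

text \<open>Normal equivalence and equality of compositions are both reduced to this relation
  between chamber representatives.\<close>

definition same_strict_order :: "'i::finite set \<Rightarrow> real ^ 'i \<Rightarrow> real ^ 'i \<Rightarrow> bool" where
  "same_strict_order I x y \<longleftrightarrow> (\<forall>i\<in>I. \<forall>j\<in>I. x $ j < x $ i \<longleftrightarrow> y $ j < y $ i)"

lemma composition_eq_iff_same_strict_order:
  assumes lin: "linear_order_on I r"
    and \<alpha>: "is_composition (card I) \<alpha>" "x \<in> rel_interior (chamber_face I r \<alpha>)"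
    and \<beta>: "is_composition (card I) \<beta>" "y \<in> rel_interior (chamber_face I r \<beta>)"
  shows "\<alpha> = \<beta> \<longleftrightarrow> same_strict_order I x y"
proof
  assume "\<alpha> = \<beta>"
  then show "same_strict_order I x y"
    using \<alpha>(2) \<beta>(2) unfolding same_strict_order_def
    by (metis rel_interior_chamber_face[OF lin \<alpha>(1)])
next
  assume same: "same_strict_order I x y"
  show "\<alpha> = \<beta>"
  proof (rule composition_eq_if_separated[OF \<alpha>(1) \<beta>(1)])
    fix a b assume "a < card I" "b < card I"
    then obtain i j where ij: "i \<in> I" "position I r i = a" "j \<in> I" "position I r j = b"
      by (metis position_surj[OF lin])
    have "separated (cuts \<alpha>) a b \<longleftrightarrow> x $ j < x $ i"
      using \<alpha>(2) ij unfolding rel_interior_chamber_face[OF lin \<alpha>(1)] by blast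
    also have "\<dots> \<longleftrightarrow> y $ j < y $ i"
      using same ij by (simp add: same_strict_order_def)
    also have "\<dots> \<longleftrightarrow> separated (cuts \<beta>) a b"
      using \<beta>(2) ij unfolding rel_interior_chamber_face[OF lin \<beta>(1)] by blast
    finally show "separated (cuts \<alpha>) a b \<longleftrightarrow> separated (cuts \<beta>) a b" .
  qed
qed

text \<open>Superlevel sets of a chamber point are initial segments of \<open>r\<close>, so
  membership is decided by comparing the position with the size.\<close>

lemma chamber_superlevel:
  assumes "linear_order_on I r" "x \<in> chamber I r" "l \<in> I"
  shows "position I r l < card {i\<in>I. c < x $ i} \<longleftrightarrow> c < x $ l"
proof
  have before: "x $ k \<le> x $ l" if "k \<in> I" "l \<in> I" "(l, k) \<in> r" for k l
    using assms(2) that unfolding chamber_def by (cases "l = k") auto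
  assume less: "c < x $ l"
  have "{j \<in> I. (j, l) \<in> r \<and> j \<noteq> l} \<subset> {i\<in>I. c < x $ i}"
    using before[OF assms(3)] less assms(3) by (fastforce intro: less_le_trans)
  then show "position I r l < card {i\<in>I. c < x $ i}"
    unfolding position_def by (intro psubset_card_mono) auto
next
  assume less: "position I r l < card {i\<in>I. c < x $ i}"
  show "c < x $ l"
  proof (rule ccontr)
    assume nless: "\<not> c < x $ l"
    have "{i\<in>I. c < x $ i} \<subseteq> {j \<in> I. (j, l) \<in> r \<and> j \<noteq> l}"
    proof
      fix i assume i: "i \<in> {i\<in>I. c < x $ i}"
      then have "position I r i < position I r l"
        using nless by (intro chamber_position_less[OF assms(1,2) _ assms(3)]) auto
      then show "i \<in> {j \<in> I. (j, l) \<in> r \<and> j \<noteq> l}"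
        using i position_less_iff[OF assms(1) _ assms(3)] by blast
    qed
    then have "card {i\<in>I. c < x $ i} \<le> position I r l"
      unfolding position_def by (intro card_mono) auto
    with less show False by simp
  qed
qed

text \<open>The cuts are the sizes of the superlevel sets of \<open>x\<close>, that is, the
  positions where its coordinates drop.\<close>

lemma composition_of_chamber_point:
  assumes lin: "linear_order_on I r" and x: "x \<in> chamber I r"
  obtains \<alpha> where "is_composition (card I) \<alpha>" "x \<in> rel_interior (chamber_face I r \<alpha>)"
proof -
  let ?S = "range (\<lambda>c. card {i\<in>I. c < x $ i})"
  have "?S \<subseteq> {..card I}" by (auto intro: card_mono)
  moreover have "0 \<in> ?S"
  proof
    \<comment> \<open>The extrema are taken over all coordinates of the ambient space, a nonempty
      set even when \<open>I\<close> is empty.\<close>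
    have "\<not> Max (range (($) x)) < x $ i" for i
      unfolding not_less by (rule Max_ge) auto
    then show "0 = card {i\<in>I. Max (range (($) x)) < x $ i}" by simp
  qed simp
  moreover have "card I \<in> ?S"
  proof
    have "Min (range (($) x)) \<le> x $ i" for i
      by (rule Min_le) auto
    then have "Min (range (($) x)) - 1 < x $ i" for i
      by (smt (verit))
    then show "card I = card {i\<in>I. Min (range (($) x)) - 1 < x $ i}" by simp
  qed simp
  ultimately obtain \<alpha> where \<alpha>: "is_composition (card I) \<alpha>" "cuts \<alpha> = ?S"
    by (rule composition_with_cuts)
  have "x $ j < x $ i \<longleftrightarrow> separated (cuts \<alpha>) (position I r i) (position I r j)"
    if "i \<in> I" "j \<in> I" for i j
  proof -
    have "separated (cuts \<alpha>) (position I r i) (position I r j) \<longleftrightarrow> (\<exists>c. c < x $ i \<and> \<not> c < x $ j)"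
      using chamber_superlevel[OF lin x] that by (simp add: separated_def \<alpha>(2) flip: not_less)
    also have "\<dots> \<longleftrightarrow> x $ j < x $ i"
      by (meson less_irrefl less_le_trans not_less)
    finally show ?thesis by simp
  qed
  then have "x \<in> rel_interior (chamber_face I r \<alpha>)"
    using x by (simp add: rel_interior_chamber_face[OF lin \<alpha>(1)])
  with \<alpha>(1) show thesis using that by blast
qed

text \<open>For uniqueness, a competing composition would come from a chamber point of the same
  orbit. That point is \<open>x\<close> again, and it determines its composition.\<close>

lemma point_composition_eqI:
  assumes lin: "linear_order_on I r" and x: "x \<in> perm_orbit I p"
    and \<alpha>: "is_composition (card I) \<alpha>" "x \<in> rel_interior (chamber_face I r \<alpha>)"
  shows "point_composition I r p = \<alpha>"
  unfolding point_composition_def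
proof (rule the_equality)
  show "is_composition (card I) \<alpha> \<and> rel_interior (chamber_face I r \<alpha>) \<inter> perm_orbit I p \<noteq> {}"
    using x \<alpha> by blast
next
  fix \<beta> assume "is_composition (card I) \<beta> \<and> rel_interior (chamber_face I r \<beta>) \<inter> perm_orbit I p \<noteq> {}"
  then obtain y where \<beta>: "is_composition (card I) \<beta>" "y \<in> rel_interior (chamber_face I r \<beta>)"
    and y: "y \<in> perm_orbit I p"
    by blast
  have "x \<in> chamber I r" "y \<in> chamber I r"
    using \<alpha>(2) \<beta>(2) by (auto simp: rel_interior_chamber_face[OF lin \<alpha>(1)] rel_interior_chamber_face[OF lin \<beta>(1)])
  moreover have "y \<in> perm_orbit I x"
    using y perm_orbit_eq[OF x] by simp
  ultimately have "y = x" using lin by (intro chamber_perm_orbit_unique)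
  then show "\<beta> = \<alpha>"
    using composition_eq_iff_same_strict_order[OF lin \<beta> \<alpha>] by (simp add: same_strict_order_def)
qed

lemma polytope_composition_orbit_polytope:
  "polytope_composition I r (orbit_polytope I p) = point_composition I r p"
  unfolding polytope_composition_def
proof (rule the_equality)
  have "point_composition I r v = point_composition I r p"
    if "v extreme_point_of orbit_polytope I p" for v
    using extreme_point_of_convex_hull[of v "perm_orbit I p"] that perm_orbit_eq[of v I p]
    by (simp add: orbit_polytope_def point_composition_def)
  then show *: "\<forall>v. v extreme_point_of orbit_polytope I p \<longrightarrow>
      point_composition I r v = point_composition I r p" by blast
  \<comment> \<open>Without an extreme point the defining condition would be vacuous and would not
    single out a composition.\<close>
  have "compact (orbit_polytope I p)" "convex (orbit_polytope I p)" "orbit_polytope I p \<noteq> {}"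
    using perm_orbit_self[of p I] finite_perm_orbit[of I p]
    by (auto simp: orbit_polytope_def finite_imp_compact_convex_hull)
  then obtain v where "v extreme_point_of orbit_polytope I p"
    by (rule extreme_point_exists_convex)
  with * show "\<alpha> = point_composition I r p"
    if "\<forall>v. v extreme_point_of orbit_polytope I p \<longrightarrow> point_composition I r v = \<alpha>" for \<alpha>
    using that by metis
qed

lemma polytope_composition_eq_iff:
  assumes lin: "linear_order_on I r" and x: "x \<in> chamber I r" and y: "y \<in> chamber I r"
  shows "polytope_composition I r (orbit_polytope I x) = polytope_composition I r (orbit_polytope I y)
    \<longleftrightarrow> same_strict_order I x y"
proof -
  obtain \<alpha> where \<alpha>: "is_composition (card I) \<alpha>" "x \<in> rel_interior (chamber_face I r \<alpha>)"
    using lin x by (rule composition_of_chamber_point)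
  obtain \<beta> where \<beta>: "is_composition (card I) \<beta>" "y \<in> rel_interior (chamber_face I r \<beta>)"
    using lin y by (rule composition_of_chamber_point)
  show ?thesis
    using composition_eq_iff_same_strict_order[OF lin \<alpha> \<beta>]
      point_composition_eqI[OF lin perm_orbit_self \<alpha>] point_composition_eqI[OF lin perm_orbit_self \<beta>]
    by (simp add: polytope_composition_orbit_polytope)
qed

section \<open>Normal fans of orbit polytopes and the strict order of coordinates\<close>

text \<open>Indexing by permutations instead of vertices lets the fans of two orbits be compared
  term by term: \<open>p\<close> enters only through the cones of its images.\<close>

lemma normal_fan_orbit_polytope:
  assumes "p \<in> coord_space I"
  shows "normal_fan I (orbit_polytope I p)
    = {coord_space I \<inter> (\<Inter>\<sigma>\<in>{\<sigma>. \<sigma> permutes I \<and> w \<in> comonotone_cone I (perm_act \<sigma> p)}.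
        comonotone_cone I (perm_act \<sigma> p)) | w. w \<in> coord_space I}"
proof -
  let ?V = "perm_orbit I p"
  note cone = normal_cone_perm_orbit[OF assms]
  have "normal_cone I ?V {v \<in> ?V. w \<in> normal_cone I ?V {v}} =
      coord_space I \<inter> (\<Inter>\<sigma>\<in>{\<sigma>. \<sigma> permutes I \<and> w \<in> comonotone_cone I (perm_act \<sigma> p)}.
        comonotone_cone I (perm_act \<sigma> p))" for w
  proof -
    have "normal_cone I ?V {v \<in> ?V. w \<in> normal_cone I ?V {v}} =
        coord_space I \<inter> (\<Inter>v\<in>{v \<in> ?V. w \<in> normal_cone I ?V {v}}. normal_cone I ?V {v})"
      by (auto simp: normal_cone_def)
    also have "\<dots> = coord_space I \<inter> (\<Inter>v\<in>{v \<in> ?V. w \<in> comonotone_cone I v}. comonotone_cone I v)"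
      using cone by auto
    also have "{v \<in> ?V. w \<in> comonotone_cone I v} =
        (\<lambda>\<sigma>. perm_act \<sigma> p) ` {\<sigma>. \<sigma> permutes I \<and> w \<in> comonotone_cone I (perm_act \<sigma> p)}"
      by (auto simp: perm_orbit_def)
    finally show ?thesis by (simp add: image_image)
  qed
  moreover have "?V \<noteq> {}" "?V \<subseteq> coord_space I"
    using perm_orbit_self[of p I] perm_orbit_coord_space[OF assms] by auto
  note normal_fan_convex_hull[OF finite_perm_orbit this]
  ultimately show ?thesis
    unfolding orbit_polytope_def by (simp only:)
qed

lemma same_strict_order_perm_act:
  assumes "same_strict_order I x y" "\<sigma> permutes I"
  shows "same_strict_order I (perm_act \<sigma> x) (perm_act \<sigma> y)"
  using assms permutes_in_image[OF permutes_inv[OF assms(2)]] by (simp add: same_strict_order_def)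

lemma same_strict_order_comonotone_cone:
  "same_strict_order I x y \<Longrightarrow> comonotone_cone I x = comonotone_cone I y"
  by (simp add: same_strict_order_def comonotone_cone_def comonotone_def)

text \<open>Permuting both points preserves the hypothesis, so each cone in the formula for
  \<open>x\<close> equals the corresponding cone for \<open>y\<close>.\<close>

lemma same_strict_order_normal_fan:
  assumes "x \<in> coord_space I" "y \<in> coord_space I" "same_strict_order I x y"
  shows "normal_fan I (orbit_polytope I x) = normal_fan I (orbit_polytope I y)"
proof -
  have "comonotone_cone I (perm_act \<sigma> x) = comonotone_cone I (perm_act \<sigma> y)" if "\<sigma> permutes I" for \<sigma>
    using assms(3) that by (intro same_strict_order_comonotone_cone same_strict_order_perm_act)
  then show ?thesis
    by (simp add: normal_fan_orbit_polytope assms(1,2) cong: conj_cong)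
qed

text \<open>
  The weight \<open>position_weight I r\<close> lies in the interior of the fundamental chamber, so \<open>x\<close> is
  the only vertex of the orbit polytope of \<open>x\<close> at which it is maximal.
\<close>

lemma normal_fan_cone_containing_position_weight:
  assumes lin: "linear_order_on I r" and x: "x \<in> chamber I r"
  shows "C \<in> normal_fan I (orbit_polytope I x) \<and> position_weight I r \<in> C \<longleftrightarrow> C = comonotone_cone I x"
proof -
  let ?V = "perm_orbit I x" and ?p = "position_weight I r"
  have xc: "x \<in> coord_space I" using x by (simp add: chamber_def)
  have V: "finite ?V" "?V \<noteq> {}" "?V \<subseteq> coord_space I"
    using perm_orbit_self[of x I] perm_orbit_coord_space[OF xc] finite_perm_orbit by auto
  note fan = normal_fan_convex_hull[OF V, folded orbit_polytope_def]
  note cone = normal_cone_perm_orbit[OF xc]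
  have p_iff: "?p \<in> normal_cone I ?V {v} \<longleftrightarrow> v = x" if "v \<in> ?V" for v
  proof -
    have "?p \<in> normal_cone I ?V {v} \<longleftrightarrow> v \<in> chamber I r"
      using comonotone_position_weight_iff[OF lin] that V(3)
      by (auto simp: cone comonotone_cone_def position_weight_coord_space)
    then show ?thesis using chamber_perm_orbit_unique[OF lin x] x that by blast
  qed
  show ?thesis
  proof
    assume C: "C \<in> normal_fan I (orbit_polytope I x) \<and> ?p \<in> C"
    then obtain w where w: "w \<in> coord_space I" "C = normal_cone I ?V {v \<in> ?V. w \<in> normal_cone I ?V {v}}"
      unfolding fan by blast
    let ?M = "{v \<in> ?V. w \<in> normal_cone I ?V {v}}"
    obtain m where "m \<in> ?V" "\<forall>u\<in>?V. w \<bullet> u \<le> w \<bullet> m" by (rule perm_orbit_maximiser)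
    then have "?M \<noteq> {}" using w(1) by (auto simp: normal_cone_def)
    moreover have "v = x" if "v \<in> ?M" for v
    proof -
      have "?p \<in> normal_cone I ?V {v}" using C w(2) that by (auto simp: normal_cone_def)
      with that show ?thesis using p_iff by blast
    qed
    ultimately have "?M = {x}" by blast
    then show "C = comonotone_cone I x" using w(2) cone[OF perm_orbit_self] by simp
  next
    assume C: "C = comonotone_cone I x"
    have x_only: "{v \<in> ?V. ?p \<in> normal_cone I ?V {v}} = {x}"
      using p_iff perm_orbit_self[of x I] by blast
    have "normal_cone I ?V {v \<in> ?V. ?p \<in> normal_cone I ?V {v}} \<in> normal_fan I (orbit_polytope I x)"
      unfolding fan mem_Collect_eq using position_weight_coord_space[of I r]
      by (intro exI[of _ ?p] conjI refl)
    then have "normal_cone I ?V {x} \<in> normal_fan I (orbit_polytope I x)"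
      unfolding x_only .
    then show "C \<in> normal_fan I (orbit_polytope I x) \<and> ?p \<in> C"
      using C cone[OF perm_orbit_self] p_iff[OF perm_orbit_self] by simp
  qed
qed

text \<open>If \<open>y\<close> were tied where \<open>x\<close> drops, the cone of \<open>y\<close>
  would contain a vector that rises from \<open>i\<close> to \<open>j\<close>, which the cone of
  \<open>x\<close> forbids.\<close>

lemma comonotone_cone_strict_order:
  assumes lin: "linear_order_on I r" and x: "x \<in> chamber I r" and y: "y \<in> chamber I r"
    and eq: "comonotone_cone I x = comonotone_cone I y"
    and ij: "i \<in> I" "j \<in> I" "x $ j < x $ i"
  shows "y $ j < y $ i"
proof (rule ccontr)
  assume not_less: "\<not> y $ j < y $ i"
  moreover have "y $ j \<le> y $ i"
    using chamber_comonotone[OF lin x y] ij by (simp add: comonotone_def)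
  ultimately have y_eq: "y $ j = y $ i" by simp
  \<comment> \<open>\<open>z\<close> follows the order of \<open>y\<close> with value 2 above the
    common level of \<open>i\<close> and \<open>j\<close> and -1 below it. Within that level it
    singles out \<open>j\<close>, a freedom that the tie allows.\<close>
  define z :: "real ^ 'a" where "z = (\<chi> k. if k \<notin> I then 0 else if y $ i < y $ k then 2
      else if y $ k < y $ i then -1 else if k = j then 1 else 0)"
  have "z \<in> comonotone_cone I y"
    by (auto simp: comonotone_cone_def comonotone_def coord_space_def z_def y_eq)
  then have "z \<in> comonotone_cone I x" using eq by simp
  then have "z $ j \<le> z $ i" using ij by (simp add: comonotone_cone_def comonotone_def)
  moreover have "z $ j = 1" "z $ i = 0" using ij y_eq by (auto simp: z_def)
  ultimately show False by simp
qed

text \<open>Each fan has exactly one cone containing the weight, so equal fans share that cone, and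
  the cone recovers the strict order.\<close>

lemma normally_equivalent_orbit_polytope_iff:
  assumes lin: "linear_order_on I r" and x: "x \<in> chamber I r" and y: "y \<in> chamber I r"
  shows "normally_equivalent I (orbit_polytope I x) (orbit_polytope I y) \<longleftrightarrow> same_strict_order I x y"
proof
  assume "normally_equivalent I (orbit_polytope I x) (orbit_polytope I y)"
  then have "comonotone_cone I x = comonotone_cone I y"
    using normal_fan_cone_containing_position_weight[OF lin x]
      normal_fan_cone_containing_position_weight[OF lin y]
    unfolding normally_equivalent_def by metis
  then show "same_strict_order I x y"
    unfolding same_strict_order_def
    using comonotone_cone_strict_order[OF lin x y] comonotone_cone_strict_order[OF lin y x] by metis
next
  assume "same_strict_order I x y"
  then show "normally_equivalent I (orbit_polytope I x) (orbit_polytope I y)"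
    using same_strict_order_normal_fan[of x I y] x y by (simp add: normally_equivalent_def chamber_def)
qed

lemma orbit_polytope_chamber_representative:
  assumes "linear_order_on I r" "is_orbit_polytope I P"
  obtains x where "x \<in> chamber I r" "P = orbit_polytope I x"
proof -
  obtain p where p: "p \<in> coord_space I" "P = orbit_polytope I p"
    using assms(2) by (auto simp: is_orbit_polytope_def)
  obtain x where x: "x \<in> chamber I r" "x \<in> perm_orbit I p"
    using assms(1) p(1) by (rule chamber_representative)
  then show thesis using p(2) perm_orbit_eq[OF x(2)] that[OF x(1)] by (simp add: orbit_polytope_def)
qed

theorem proposition3p16:
  fixes I :: "'i::finite set" and r :: "'i rel" and P Q :: "(real ^ 'i) set"
  assumes "linear_order_on I r"
    and "is_orbit_polytope I P" and "is_orbit_polytope I Q"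
  shows "normally_equivalent I P Q \<longleftrightarrow> polytope_composition I r P = polytope_composition I r Q"
proof -
  obtain x where x: "x \<in> chamber I r" "P = orbit_polytope I x"
    using assms(1,2) by (rule orbit_polytope_chamber_representative)
  obtain y where y: "y \<in> chamber I r" "Q = orbit_polytope I y"
    using assms(1,3) by (rule orbit_polytope_chamber_representative)
  show ?thesis
    unfolding x(2) y(2) normally_equivalent_orbit_polytope_iff[OF assms(1) x(1) y(1)]
      polytope_composition_eq_iff[OF assms(1) x(1) y(1)] ..
qed

end
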